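(* Let $v\geq 2$. The graph $\Gamma(2,v)$ defined below is, up to isomorphism, the unique maximal strongly $(2,v)$-clique-partitioned graph; moreover $\Gamma(2,v)$ is isomorphic to the complete graph $K_{2v}$ with the edges of a Hamiltonian cycle removed.
   Context: A $v$-clique is a set of $v$ pairwise adjacent vertices. A graph of order $nv$ is weakly $(n,v)$-clique-partitioned if its vertex set can be decomposed in a unique way into $n$ vertex-disjoint $v$-cliques; it is strongly $(n,v)$-clique-partitioned if moreover the only $v$-cliques in it are the $n$ cliques of that decomposition. Every strongly $(n,v)$-clique-partitioned graph has at most $\frac{n}{2}v(v-1)+\frac{nv(n-1)(v-2)}{2}$ edges; one is called maximal if it has exactly this many edges. The graph $\Gamma(n,v)$ has vertex set $\{(i,j):0\leq i\leq n-1,\ 0\leq j\leq v-1\}$, and $(i,j)$ is adjacent to $(k,\ell)$ if and only if one of: (1) $i=k$ and $j\neq \ell$; (2) $i<k$ and $\ell-j\not\equiv 0,1 \pmod v$; (3) $i>k$ and $j-\ell\not\equiv 0,1\pmod v$. *)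

theory Defs
  imports
    Complex_Main
    "HOL-Library.Disjoint_Sets"
    "HOL-Number_Theory.Cong"
    "Graph_Theory.Graph_Theory"
begin

text \<open>
  Finite simple graphs are rendered by \<^locale>\<open>pair_graph\<close>: finite, symmetric, loop-free
  digraphs without parallel arcs. An undirected edge thus corresponds to two opposite arcs.
\<close>

definition edges :: "'a pair_pre_digraph \<Rightarrow> 'a set set" where
  "edges G = {{x, y} | x y. (x, y) \<in> parcs G}"

definition graph_iso :: "'a pair_pre_digraph \<Rightarrow> 'b pair_pre_digraph \<Rightarrow> bool" where
  "graph_iso G H \<longleftrightarrow> digraph_iso (with_proj G) (with_proj H)"

definition is_clique :: "'a pair_pre_digraph \<Rightarrow> nat \<Rightarrow> 'a set \<Rightarrow> bool" where
  "is_clique G v S \<longleftrightarrow> S \<subseteq> pverts G \<and> finite S \<and> card S = v \<and>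
     (\<forall>x\<in>S. \<forall>y\<in>S. x \<noteq> y \<longrightarrow> (x, y) \<in> parcs G)"

definition clique_decomposition :: "'a pair_pre_digraph \<Rightarrow> nat \<Rightarrow> nat \<Rightarrow> 'a set set \<Rightarrow> bool" where
  "clique_decomposition G n v P \<longleftrightarrow>
     partition_on (pverts G) P \<and> finite P \<and> card P = n \<and> (\<forall>S\<in>P. is_clique G v S)"

definition weakly_clique_partitioned :: "nat \<Rightarrow> nat \<Rightarrow> 'a pair_pre_digraph \<Rightarrow> bool" where
  "weakly_clique_partitioned n v G \<longleftrightarrow>
     pair_graph G \<and> card (pverts G) = n * v \<and> (\<exists>!P. clique_decomposition G n v P)"

definition strongly_clique_partitioned :: "nat \<Rightarrow> nat \<Rightarrow> 'a pair_pre_digraph \<Rightarrow> bool" where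
  "strongly_clique_partitioned n v G \<longleftrightarrow>
     weakly_clique_partitioned n v G \<and>
     (\<forall>P. clique_decomposition G n v P \<longrightarrow> (\<forall>S. is_clique G v S \<longrightarrow> S \<in> P))"

definition maximal_strongly_clique_partitioned :: "nat \<Rightarrow> nat \<Rightarrow> 'a pair_pre_digraph \<Rightarrow> bool" where
  "maximal_strongly_clique_partitioned n v G \<longleftrightarrow>
     strongly_clique_partitioned n v G \<and>
     real (card (edges G)) =
       real n / 2 * real v * (real v - 1) + real n * real v * (real n - 1) * (real v - 2) / 2"

definition Gamma :: "nat \<Rightarrow> nat \<Rightarrow> (nat \<times> nat) pair_pre_digraph" where
  "Gamma n v =
     \<lparr> pverts = {0..<n} \<times> {0..<v},
       parcs = {((i, j), (k, l)) | i j k l.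
         i < n \<and> j < v \<and> k < n \<and> l < v \<and>
         ((i = k \<and> j \<noteq> l) \<or>
          (i < k \<and> \<not> [int l - int j = 0] (mod int v) \<and> \<not> [int l - int j = 1] (mod int v)) \<or>
          (i > k \<and> \<not> [int j - int l = 0] (mod int v) \<and> \<not> [int j - int l = 1] (mod int v)))} \<rparr>"

text \<open>
  Cycles are closed arc walks. The length bound excludes walking an undirected edge back and
  forth, which \<^const>\<open>pre_digraph.cycle\<close> admits as a cycle of length 2.
\<close>

definition hamiltonian_cycle :: "'a pair_pre_digraph \<Rightarrow> ('a \<times> 'a) awalk \<Rightarrow> bool" where
  "hamiltonian_cycle G C \<longleftrightarrow>
     pre_digraph.cycle (with_proj G) C \<and> 3 \<le> length C \<and> fst ` set C = pverts G"

definition delete_edges :: "'a pair_pre_digraph \<Rightarrow> ('a \<times> 'a) set \<Rightarrow> 'a pair_pre_digraph" where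
  "delete_edges G A = \<lparr> pverts = pverts G, parcs = parcs G - (A \<union> A\<inverse>) \<rparr>"

end

theory Submission
  imports Defs
begin

text \<open>
  Let \<open>G\<close> be maximal with cliques \<open>A\<close> and \<open>B\<close>, and let \<open>H\<close> be its complement, a bipartite graph on
  \<open>A \<union> B\<close> with \<open>2v\<close> edges. A vertex \<open>a \<in> A\<close> of \<open>H\<close>-degree at most 1 would form, together with
  vertices of \<open>B\<close>, a third \<open>v\<close>-clique; hence all degrees are at least 2, and by counting they are
  equal to 2. If \<open>X\<close> is a union of components of \<open>H\<close>, then \<open>(X \<inter> A) \<union> (B - X)\<close> and
  \<open>(X \<inter> B) \<union> (A - X)\<close> are cliques of \<open>G\<close>, and one of them has at least \<open>v\<close> elements, which forces
  \<open>X\<close> to be trivial. So \<open>H\<close> is a connected 2-regular graph, that is, a cycle of length \<open>2v\<close>.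
  The complement of \<open>\<Gamma>(2,v)\<close> is the cycle \<open>(1,0), (0,0), (1,1), (0,1), \<dots>\<close>.
\<close>

section \<open>Connected 2-regular relations\<close>

lemma card_two_subset_eq:
  assumes "card N = 2" "a \<in> N" "b \<in> N" "a \<noteq> b"
  shows "N = {a, b}"
proof -
  have "finite N" using assms(1) by (metis card.infinite zero_neq_numeral)
  then show ?thesis using assms card_seteq[of N "{a, b}"] by auto
qed

text \<open>The two ends of a longest path are adjacent, so that the path closes up to a component.\<close>

lemma two_regular_cycle:
  fixes R :: "'a \<Rightarrow> 'a \<Rightarrow> bool"
  assumes fin: "finite V" and ne: "V \<noteq> {}"
    and RV: "\<And>x y. R x y \<Longrightarrow> x \<in> V"
    and sym: "\<And>x y. R x y \<Longrightarrow> R y x"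
    and irr: "\<And>x. \<not> R x x"
    and deg: "\<And>x. x \<in> V \<Longrightarrow> card {y. R x y} = 2"
    and conn: "\<And>X. X \<subseteq> V \<Longrightarrow> X \<noteq> {} \<Longrightarrow> (\<And>x y. x \<in> X \<Longrightarrow> R x y \<Longrightarrow> y \<in> X) \<Longrightarrow> X = V"
  obtains f where "bij_betw f {..<card V} V"
    "\<And>i j. i < card V \<Longrightarrow> j < card V \<Longrightarrow>
       R (f i) (f j) \<longleftrightarrow> j = Suc i mod card V \<or> i = Suc j mod card V"
proof -
  \<comment> \<open>\<open>P\<close> describes the simple paths of \<open>R\<close>. Their lengths
    are at most \<open>card V\<close>, so a longest one exists.\<close>
  define P where "P xs \<longleftrightarrow> set xs \<subseteq> V \<and> distinct xs \<and> successively R xs \<and> xs \<noteq> []" for xs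
  obtain x where "x \<in> V" using ne by auto
  then have "P [x]" by (simp add: P_def)
  moreover have "\<forall>xs. P xs \<longrightarrow> length xs < Suc (card V)"
    unfolding P_def using fin by (metis card_mono distinct_card le_imp_less_Suc)
  ultimately obtain xs where xs: "P xs" and long: "\<And>ys. P ys \<Longrightarrow> length ys \<le> length xs"
    using ex_has_greatest_nat[of P "[x]" length "Suc (card V)"] by blast
  define n where "n = length xs"
  have nth_V: "xs ! i \<in> V" if "i < n" for i using xs that by (auto simp: P_def n_def)
  have nth_inj: "xs ! i = xs ! j \<longleftrightarrow> i = j" if "i < n" "j < n" for i j
    using xs that by (auto simp: P_def n_def nth_eq_iff_index_eq)
  have step: "R (xs ! i) (xs ! Suc i)" if "Suc i < n" for i
    using xs that by (auto simp: P_def n_def successively_conv_nth)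
  have "n > 0" using xs by (auto simp: P_def n_def)
  have last_xs: "last xs = xs ! (n - 1)" using xs by (simp add: P_def n_def last_conv_nth)
  \<comment> \<open>A neighbour of the last vertex outside the path would prolong it, against
    maximality.\<close>
  have nbrs_last: "{y. R (xs ! (n - 1)) y} \<subseteq> set xs - {xs ! (n - 1)}"
  proof
    fix y assume "y \<in> {y. R (xs ! (n - 1)) y}"
    then have y: "R (xs ! (n - 1)) y" by simp
    have "y \<in> set xs"
    proof (rule ccontr)
      assume "y \<notin> set xs"
      with xs y RV[OF sym[OF y]] have "P (xs @ [y])"
        by (auto simp: P_def successively_append_iff last_xs)
      from long[OF this] show False by simp
    qed
    with y irr show "y \<in> set xs - {xs ! (n - 1)}" by auto
  qed
  have "card (set xs - {xs ! (n - 1)}) = n - 1"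
    using xs \<open>n > 0\<close> by (simp add: P_def n_def distinct_card)
  with card_mono[OF _ nbrs_last] deg[OF nth_V[of "n - 1"]] \<open>n > 0\<close> have n3: "n \<ge> 3" by simp
  \<comment> \<open>The last vertex has two neighbours, so one of them, \<open>z\<close>, is not its
    predecessor on the path.\<close>
  have "\<not> {y. R (xs ! (n - 1)) y} \<subseteq> {xs ! (n - 2)}"
  proof
    assume "{y. R (xs ! (n - 1)) y} \<subseteq> {xs ! (n - 2)}"
    from card_mono[OF _ this] deg[OF nth_V[of "n - 1"]] n3 show False by simp
  qed
  then obtain z where z: "R (xs ! (n - 1)) z" "z \<noteq> xs ! (n - 2)" by auto
  with nbrs_last have "z \<in> set xs" by blast
  then obtain i where i: "i < n" "z = xs ! i"
    by (auto simp: in_set_conv_nth n_def)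
  have "i \<noteq> n - 1" using i z irr by auto
  moreover have "i \<noteq> n - 2" using i z by auto
  ultimately have i_less: "Suc i < n - 1" using i by linarith
  \<comment> \<open>An inner vertex \<open>xs ! i\<close> already has its two neighbours on the
    path, and \<open>Suc i < n - 1\<close> makes the last vertex a third one. Only the first vertex
    remains for \<open>z\<close>.\<close>
  have "i = 0"
  proof (rule ccontr)
    assume "i \<noteq> 0"
    have "{y. R (xs ! i) y} = {xs ! (i - 1), xs ! Suc i}"
      using sym[OF step[of "i - 1"]] step[of i] \<open>i \<noteq> 0\<close> i i_less nth_inj[of "i - 1" "Suc i"]
      by (intro card_two_subset_eq deg nth_V) auto
    moreover have "R (xs ! i) (xs ! (n - 1))" using z i sym by auto
    ultimately have "xs ! (n - 1) = xs ! (i - 1) \<or> xs ! (n - 1) = xs ! Suc i" by auto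
    with nth_inj[of "n - 1" "i - 1"] nth_inj[of "n - 1" "Suc i"] i i_less \<open>i \<noteq> 0\<close>
    show False by auto
  qed
  with z i have closing: "R (xs ! (n - 1)) (xs ! 0)" by simp
  have succ: "R (xs ! i) (xs ! (Suc i mod n))" if "i < n" for i
  proof (cases "Suc i = n")
    case True
    then show ?thesis using closing by auto
  qed (use step[of i] that in auto)
  \<comment> \<open>The cyclic predecessor. It differs from the cyclic successor because
    \<open>n\<close> is at least 3, so the two of them exhaust the neighbours.\<close>
  define pred where "pred i = (if i = 0 then n - 1 else i - 1)" for i
  have pred_less: "pred i < n" and Suc_pred_mod: "Suc (pred i) mod n = i"
    and pred_neq: "pred i \<noteq> Suc i mod n" if "i < n" for i
    using that n3 by (auto simp: pred_def mod_Suc)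
  have nbrs: "{y. R (xs ! i) y} = {xs ! (Suc i mod n), xs ! pred i}" if "i < n" for i
    using succ[OF that] sym[OF succ[OF pred_less[OF that]]] pred_neq[OF that] pred_less[OF that] that
      nth_inj[of "Suc i mod n" "pred i"]
    by (intro card_two_subset_eq deg nth_V) (auto simp: Suc_pred_mod)
  \<comment> \<open>The path contains all neighbours of its vertices, so connectedness makes it
    exhaust \<open>V\<close>.\<close>
  have "set xs = V"
  proof (rule conn)
    fix x y assume "x \<in> set xs" "R x y"
    then obtain i where "i < n" "x = xs ! i" by (auto simp: in_set_conv_nth n_def)
    with \<open>R x y\<close> nbrs[of i] have "y = xs ! (Suc i mod n) \<or> y = xs ! pred i" by auto
    then show "y \<in> set xs"
      using pred_less[OF \<open>i < n\<close>] \<open>n > 0\<close> by (auto simp: n_def intro!: nth_mem)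
  qed (use xs in \<open>auto simp: P_def\<close>)
  then have n: "n = card V" using xs by (auto simp: n_def P_def distinct_card)
  show thesis
  proof (rule that[of "(!) xs"])
    show "bij_betw ((!) xs) {..<card V} V"
      using xs \<open>set xs = V\<close> n by (intro bij_betw_nth) (auto simp: P_def n_def)
    fix i j assume ij: "i < card V" "j < card V"
    have "R (xs ! i) (xs ! j) \<longleftrightarrow> xs ! j \<in> {xs ! (Suc i mod n), xs ! pred i}"
      using nbrs[of i] ij n by blast
    also have "\<dots> \<longleftrightarrow> j = Suc i mod n \<or> j = pred i"
      using ij n nth_inj[of j "Suc i mod n"] nth_inj[of j "pred i"] pred_less[of i] by auto
    also have "j = pred i \<longleftrightarrow> i = Suc j mod n"
      using ij n n3 by (auto simp: pred_def mod_Suc)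
    finally show "R (xs ! i) (xs ! j) \<longleftrightarrow> j = Suc i mod card V \<or> i = Suc j mod card V"
      by (simp add: n)
  qed
qed

section \<open>Complements of cycles\<close>

text \<open>An isomorphism from the complement of the cycle 0, 1, ..., m-1 onto \<open>G\<close>,
  stated as a numbering of the vertices. All graphs in the theorem are compared through such
  numberings with m = 2v.\<close>

definition cocycle_labelling :: "'a pair_pre_digraph \<Rightarrow> nat \<Rightarrow> (nat \<Rightarrow> 'a) \<Rightarrow> bool" where
  "cocycle_labelling G m f \<longleftrightarrow> bij_betw f {..<m} (pverts G) \<and>
     (\<forall>i<m. \<forall>j<m. (f i, f j) \<in> parcs G \<longleftrightarrow> i \<noteq> j \<and> j \<noteq> Suc i mod m \<and> i \<noteq> Suc j mod m)"

lemma graph_isoI: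
  assumes G: "pair_wf_digraph G" and H: "pair_wf_digraph H"
    and bij: "bij_betw h (pverts G) (pverts H)"
    and arcs: "\<And>x y. x \<in> pverts G \<Longrightarrow> y \<in> pverts G \<Longrightarrow>
      (h x, h y) \<in> parcs H \<longleftrightarrow> (x, y) \<in> parcs G"
  shows "graph_iso G H"
proof -
  interpret G: pair_wf_digraph G by fact
  interpret H: pair_wf_digraph H by fact
  \<comment> \<open>A library isomorphism also carries a map on arcs and the new end maps. Arcs are
    pairs of vertices here, so \<open>h\<close> determines all of it.\<close>
  let ?f = "\<lparr>iso_verts = h, iso_arcs = map_prod h h, iso_head = snd, iso_tail = fst\<rparr>"
  have inj: "inj_on h (pverts G)" and img: "h ` pverts G = pverts H"
    using bij by (auto simp: bij_betw_def)
  have "map_prod h h ` parcs G = parcs H"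
  proof (intro equalityI subsetI)
    fix e assume "e \<in> parcs H"
    moreover obtain a b where "e = (a, b)" by (cases e)
    ultimately have "(a, b) \<in> parcs H" "a \<in> h ` pverts G" "b \<in> h ` pverts G"
      using H.wellformed' img by blast+
    then show "e \<in> map_prod h h ` parcs G" using arcs \<open>e = (a, b)\<close> by force
  qed (use arcs G.wellformed' in auto)
  then have "with_proj H = app_iso ?f (with_proj G)"
    using img by (simp add: app_iso_def with_proj_def)
  moreover have "inj_on (map_prod h h) (parcs G)"
    by (rule inj_on_subset[OF map_prod_inj_on[OF inj inj]]) (auto dest: G.wellformed')
  then have "pre_digraph.digraph_isomorphism (with_proj G) ?f"
    using inj G.wf_digraph by (auto simp: pre_digraph.digraph_isomorphism_def)
  ultimately show ?thesis by (auto simp: graph_iso_def digraph_iso_def)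
qed

text \<open>Both graphs are copies of the same graph on \<open>{..<m}\<close>, so going back along
  \<open>f\<close> and forward along \<open>g\<close> preserves adjacency.\<close>

lemma graph_iso_cocycle_labelling:
  assumes "pair_wf_digraph G" "pair_wf_digraph H"
    and f: "cocycle_labelling G m f" and g: "cocycle_labelling H m g"
  shows "graph_iso G H"
proof (rule graph_isoI)
  have bij_f: "bij_betw f {..<m} (pverts G)" and bij_g: "bij_betw g {..<m} (pverts H)"
    using f g by (auto simp: cocycle_labelling_def)
  let ?h = "g \<circ> the_inv_into {..<m} f"
  show "bij_betw ?h (pverts G) (pverts H)"
    using bij_f bij_g bij_betw_the_inv_into bij_betw_trans by blast
  have h: "?h (f i) = g i" if "i < m" for i
    using bij_f that by (simp add: bij_betw_def the_inv_into_f_f)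
  fix x y assume "x \<in> pverts G" "y \<in> pverts G"
  then obtain i j where "i < m" "j < m" "x = f i" "y = f j"
    using bij_betw_imp_surj_on[OF bij_f] by (metis imageE lessThan_iff)
  then show "(?h x, ?h y) \<in> parcs H \<longleftrightarrow> (x, y) \<in> parcs G"
    using f g h by (simp add: cocycle_labelling_def del: comp_apply)
qed fact+

section \<open>The complete graph without a Hamiltonian cycle\<close>

definition complete_pair_graph :: "nat \<Rightarrow> nat pair_pre_digraph" where
  "complete_pair_graph m = \<lparr>pverts = {..<m}, parcs = {(i, j). i < m \<and> j < m \<and> i \<noteq> j}\<rparr>"

text \<open>Each edge is listed in one direction only, as a walk requires;
  \<open>delete_edges\<close> removes the opposite arcs too.\<close>

definition cycle_arcs :: "nat \<Rightarrow> (nat \<times> nat) list" where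
  "cycle_arcs m = map (\<lambda>i. (i, Suc i mod m)) [0..<m]"

lemma complete_digraph_complete_pair_graph:
  "complete_digraph m (with_proj (complete_pair_graph m))"
  by (auto simp: complete_digraph_pair_def complete_pair_graph_def)

lemma pcas_path: "i \<le> k \<Longrightarrow> pcas i (map (\<lambda>j. (j, Suc j)) [i..<k]) k"
proof (induction "k - i" arbitrary: i)
  case (Suc d)
  then have "[i..<k] = i # [Suc i..<k]" by (simp add: upt_conv_Cons)
  then show ?case using Suc.hyps(1)[of "Suc i"] Suc.hyps(2) by simp
qed simp

lemma pcas_append: "pcas u p w \<Longrightarrow> pcas w q x \<Longrightarrow> pcas u (p @ q) x"
  by (induction p arbitrary: u) auto

lemma hamiltonian_cycle_cycle_arcs:
  assumes "m \<ge> 3"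
  shows "hamiltonian_cycle (complete_pair_graph m) (cycle_arcs m)"
proof -
  let ?K = "complete_pair_graph m"
  obtain k where m: "m = Suc k" using assms by (cases m) auto
  \<comment> \<open>Only the last arc wraps around, so it is split off and the rest is a plain path
    from 0 to \<open>k\<close>.\<close>
  have split: "cycle_arcs m = map (\<lambda>j. (j, Suc j)) [0..<k] @ [(k, 0)]"
    by (auto simp: cycle_arcs_def m)
  have "pcas 0 (cycle_arcs m) 0"
    unfolding split using pcas_path[of 0 k] by (intro pcas_append[of _ _ k]) auto
  moreover have "set (cycle_arcs m) \<subseteq> parcs ?K"
    using assms by (auto simp: cycle_arcs_def complete_pair_graph_def mod_Suc split: if_splits)
  ultimately have "pre_digraph.awalk (with_proj ?K) 0 (cycle_arcs m) 0"
    using assms by (auto simp: pre_digraph.awalk_def cas_with_proj_eq complete_pair_graph_def)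
  moreover have "pawalk_verts 0 (cycle_arcs m) = map fst (cycle_arcs m) @ [0]"
    using pre_digraph.awalk_verts_conv[of "with_proj ?K" 0 "cycle_arcs m"] split
    by (simp add: awalk_verts_with_proj_eq)
  then have "pawalk_verts 0 (cycle_arcs m) = [0..<m] @ [0]"
    by (simp add: cycle_arcs_def comp_def)
  \<comment> \<open>The start vertex 0 recurs at the end of the walk; the definition of a cycle asks
    for distinctness after dropping its first occurrence.\<close>
  then have "distinct (tl (pawalk_verts 0 (cycle_arcs m)))"
    by (simp add: m upt_conv_Cons del: upt_Suc)
  moreover have "fst ` set (cycle_arcs m) = pverts ?K"
    by (auto simp: cycle_arcs_def complete_pair_graph_def image_image)
  moreover have "length (cycle_arcs m) = m" by (simp add: cycle_arcs_def)
  ultimately show ?thesis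
    using assms by (auto simp: hamiltonian_cycle_def pre_digraph.cycle_def awalk_verts_with_proj_eq)
qed

lemma pair_wf_delete_edges: "pair_wf_digraph G \<Longrightarrow> pair_wf_digraph (delete_edges G S)"
  by (auto simp: pair_wf_digraph_def delete_edges_def)

lemma pair_wf_complete_pair_graph: "pair_wf_digraph (complete_pair_graph m)"
  by unfold_locales (auto simp: complete_pair_graph_def)

lemma cocycle_labelling_delete_edges:
  "cocycle_labelling (delete_edges (complete_pair_graph m) (set (cycle_arcs m))) m id"
  by (auto simp: cocycle_labelling_def delete_edges_def complete_pair_graph_def cycle_arcs_def)

section \<open>Graphs covered by two disjoint cliques\<close>

lemma is_cliqueI:
  assumes "pair_graph G" "S \<subseteq> pverts G" "card S = v" "v > 0"
    and "\<And>x y. x \<in> S \<Longrightarrow> y \<in> S \<Longrightarrow> x \<noteq> y \<Longrightarrow> (x, y) \<in> parcs G"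
  shows "is_clique G v S"
  using assms by (auto simp: is_clique_def intro: card_ge_0_finite)

locale two_cliques = pair_graph G for G :: "'a pair_pre_digraph" +
  fixes v :: nat and A B :: "'a set"
  assumes verts_eq: "pverts G = A \<union> B" and disjoint: "A \<inter> B = {}"
    and clique_A: "is_clique G v A" and clique_B: "is_clique G v B"
begin

lemma two_cliques_swap: "two_cliques G v B A"
  using verts_eq disjoint clique_A clique_B by unfold_locales auto

lemma sym_parcs: "(x, y) \<in> parcs G \<Longrightarrow> (y, x) \<in> parcs G"
  using arcs_symmetric by blast

lemma finite_A: "finite A" and finite_B: "finite B" and card_A: "card A = v" and card_B: "card B = v"
  and adj_A: "\<And>x y. x \<in> A \<Longrightarrow> y \<in> A \<Longrightarrow> x \<noteq> y \<Longrightarrow> (x, y) \<in> parcs G"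
  and adj_B: "\<And>x y. x \<in> B \<Longrightarrow> y \<in> B \<Longrightarrow> x \<noteq> y \<Longrightarrow> (x, y) \<in> parcs G"
  using clique_A clique_B by (auto simp: is_clique_def)

text \<open>Every pair of vertices is an edge or a non-adjacent pair. The latter must cross between
  the cliques, and disjointness of \<open>A\<close> and \<open>B\<close> orients it uniquely as an
  element of \<open>A \<times> B\<close>.\<close>

lemma card_edges_add_card_non_arcs:
  "card (edges G) + card (A \<times> B - parcs G) = (2 * v) choose 2"
proof -
  let ?N = "A \<times> B - parcs G" and ?p = "\<lambda>(a, b). {a, b}"
  have fin: "finite (pverts G)" using verts_eq finite_A finite_B by simp
  have "edges G \<subseteq> Pow (pverts G)" by (auto simp: edges_def dest: wellformed')
  then have "finite (edges G)" using fin finite_subset by blast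
  moreover have "finite (?p ` ?N)" using finite_A finite_B by auto
  moreover have "edges G \<inter> ?p ` ?N = {}"
    using sym_parcs by (fastforce simp: edges_def doubleton_eq_iff)
  moreover have "inj_on ?p ?N"
    using disjoint by (auto simp: inj_on_def doubleton_eq_iff)
  ultimately have "card (edges G) + card ?N = card (edges G \<union> ?p ` ?N)"
    by (simp add: card_Un_disjoint card_image)
  also have "edges G \<union> ?p ` ?N = {S. S \<subseteq> pverts G \<and> card S = 2}"
  proof (intro equalityI subsetI)
    fix S assume "S \<in> edges G \<union> ?p ` ?N"
    then obtain x y where "S = {x, y}" "x \<in> pverts G" "y \<in> pverts G" "x \<noteq> y"
      using verts_eq disjoint wellformed' no_loops by (auto simp: edges_def) fastforce+
    then show "S \<in> {S. S \<subseteq> pverts G \<and> card S = 2}" by simp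
  next
    fix S assume "S \<in> {S. S \<subseteq> pverts G \<and> card S = 2}"
    then obtain x y where S: "S = {x, y}" "x \<noteq> y" "x \<in> A \<union> B" "y \<in> A \<union> B"
      using verts_eq by (auto simp: card_2_iff)
    show "S \<in> edges G \<union> ?p ` ?N"
    proof (cases "(x, y) \<in> parcs G")
      case False
      then have "(x, y) \<in> ?N \<or> (y, x) \<in> ?N"
        using S adj_A adj_B sym_parcs by blast
      then show ?thesis using S(1) by (force simp: insert_commute)
    qed (use S in \<open>auto simp: edges_def\<close>)
  qed
  also have "card \<dots> = card (pverts G) choose 2" by (rule n_subsets[OF fin])
  also have "card (pverts G) = 2 * v"
    using verts_eq disjoint finite_A finite_B card_A card_B by (simp add: card_Un_disjoint)
  finally show ?thesis .
qed

text \<open>For n = 2 the extremal number of edges is v(2v-3) = v(2v-1) - 2v, which is 2v less than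
  the number of all pairs.\<close>

lemma maximal_iff_card_non_arcs:
  "maximal_strongly_clique_partitioned 2 v G \<longleftrightarrow>
     strongly_clique_partitioned 2 v G \<and> card (A \<times> B - parcs G) = 2 * v"
proof -
  let ?N = "card (A \<times> B - parcs G)"
  have "real (card (edges G)) + real ?N = real v * (2 * real v - 1)"
  \<comment> \<open>The case 0 is separate because \<open>2 * v - 1\<close> is truncated on natural
    numbers.\<close>
  proof (cases v)
    case 0
    then show ?thesis
      using card_edges_add_card_non_arcs by (simp add: choose_two)
  next
    case (Suc w)
    have "(2 * v) choose 2 = v * (2 * v - 1)" by (simp add: choose_two)
    then have "real (card (edges G) + ?N) = real (v * (2 * v - 1))"
      using card_edges_add_card_non_arcs by simp
    then show ?thesis using Suc by (simp add: algebra_simps)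
  qed
  moreover have "real 2 / 2 * real v * (real v - 1) + real 2 * real v * (real 2 - 1) * (real v - 2) / 2 =
      real v * (2 * real v - 1) - 2 * real v"
    by (simp add: field_simps)
  ultimately show ?thesis
    unfolding maximal_strongly_clique_partitioned_def by auto
qed

end

section \<open>Two cliques that are the only v-cliques\<close>

locale only_two_cliques = two_cliques +
  assumes only: "\<And>S. is_clique G v S \<Longrightarrow> S = A \<or> S = B"
    and v_ge_2: "v \<ge> 2"
begin

lemma only_two_cliques_swap: "only_two_cliques G v B A"
  using two_cliques_swap only v_ge_2 by (auto simp: only_two_cliques_def only_two_cliques_axioms_def)

lemma strongly: "strongly_clique_partitioned 2 v G"
proof -
  have "A \<noteq> {}" "B \<noteq> {}" using card_A card_B v_ge_2 by auto
  with disjoint have "A \<noteq> B" by auto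
  have "clique_decomposition G 2 v {A, B}"
    using verts_eq disjoint clique_A clique_B \<open>A \<noteq> {}\<close> \<open>B \<noteq> {}\<close> \<open>A \<noteq> B\<close>
    by (auto simp: clique_decomposition_def partition_on_def disjoint_def)
  \<comment> \<open>A decomposition consists of v-cliques, so it lies in \<open>{A, B}\<close>, and
    it has two members.\<close>
  moreover have unique: "P = {A, B}" if "clique_decomposition G 2 v P" for P
  proof -
    have "P \<subseteq> {A, B}" using that only by (auto simp: clique_decomposition_def)
    then show ?thesis
      using that \<open>A \<noteq> B\<close> by (intro card_subset_eq) (auto simp: clique_decomposition_def)
  qed
  moreover have "card (pverts G) = 2 * v"
    using verts_eq disjoint finite_A finite_B card_A card_B by (simp add: card_Un_disjoint)
  ultimately show ?thesis
    using pair_graph only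
    by (auto simp: strongly_clique_partitioned_def weakly_clique_partitioned_def)
qed

text \<open>Any v-subset of a clique \<open>W\<close> is a v-clique, hence equal to \<open>A\<close>
  or \<open>B\<close>.\<close>

lemma large_clique:
  assumes W: "W \<subseteq> pverts G" "\<And>x y. x \<in> W \<Longrightarrow> y \<in> W \<Longrightarrow> x \<noteq> y \<Longrightarrow> (x, y) \<in> parcs G"
    and "card W \<ge> v"
  shows "A \<subseteq> W \<or> B \<subseteq> W"
proof -
  obtain S where "S \<subseteq> W" "card S = v"
    using \<open>card W \<ge> v\<close> obtain_subset_with_card_n by blast
  then have "is_clique G v S"
    using W(1) v_ge_2 pair_graph by (intro is_cliqueI W(2)) auto
  with only \<open>S \<subseteq> W\<close> show ?thesis by blast
qed

lemma two_le_card_non_nbrs: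
  assumes "a \<in> A"
  shows "2 \<le> card {b \<in> B. (a, b) \<notin> parcs G}"
proof (rule ccontr)
  let ?N = "{b \<in> B. (a, b) \<notin> parcs G}"
  assume "\<not> 2 \<le> card ?N"
  moreover have "card (B - ?N) = v - card ?N"
    using finite_B card_B by (simp add: card_Diff_subset)
  ultimately have "v - 1 \<le> card (B - ?N)" by simp
  then obtain T where T: "T \<subseteq> B - ?N" "card T = v - 1"
    by (rule obtain_subset_with_card_n)
  have "finite T" using T finite_B by (meson finite_Diff finite_subset)
  have "a \<notin> B" using assms disjoint by auto
  have "is_clique G v (insert a T)"
  proof (rule is_cliqueI)
    show "card (insert a T) = v" using T \<open>a \<notin> B\<close> \<open>finite T\<close> v_ge_2 by (auto simp: card_insert_if)
    fix x y assume "x \<in> insert a T" "y \<in> insert a T" "x \<noteq> y"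
    then show "(x, y) \<in> parcs G" using T adj_B sym_parcs by blast
  qed (use T assms verts_eq v_ge_2 pair_graph in auto)
  then have "insert a T = A" using only \<open>a \<notin> B\<close> by auto
  \<comment> \<open>Since v is at least 2, the new clique meets \<open>B\<close>, so it is not
    \<open>A\<close>; it contains \<open>a\<close>, so it is not \<open>B\<close>.\<close>
  moreover have "T \<noteq> {}" using T v_ge_2 by auto
  ultimately show False using T disjoint by auto
qed

text \<open>The numbers of non-neighbours sum to 2v over the v vertices of \<open>A\<close>, and
  each is at least 2, so none exceeds 2.\<close>

lemma card_non_nbrs:
  assumes "card (A \<times> B - parcs G) = 2 * v" "a \<in> A"
  shows "card {b \<in> B. (a, b) \<notin> parcs G} = 2"
proof -
  let ?d = "\<lambda>a. card {b \<in> B. (a, b) \<notin> parcs G}"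
  have "A \<times> B - parcs G = (SIGMA a:A. {b \<in> B. (a, b) \<notin> parcs G})" by auto
  then have "(\<Sum>a\<in>A. ?d a) = 2 * v"
    using assms(1) finite_A finite_B by (simp add: card_SigmaI)
  then have "(\<Sum>a\<in>A. 2) = (\<Sum>a\<in>A. ?d a)" using card_A by simp
  from sum_mono_inv[OF this two_le_card_non_nbrs assms(2) finite_A] show ?thesis by simp
qed

lemma card_non_arcs_swap: "card (B \<times> A - parcs G) = card (A \<times> B - parcs G)"
proof -
  have "B \<times> A - parcs G = prod.swap ` (A \<times> B - parcs G)" using sym_parcs by auto
  then show ?thesis by (simp add: card_image)
qed

text \<open>No non-adjacent pair joins \<open>X\<close> to its complement, so
  \<open>X \<inter> A\<close> and \<open>B - X\<close> together form a clique. If it contains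
  \<open>A\<close>, then \<open>A \<subseteq> X\<close>, and \<open>X\<close> absorbs
  \<open>B\<close> because each vertex of \<open>B\<close> has a non-neighbour in \<open>A\<close>.
  If it contains \<open>B\<close>, then \<open>X\<close> misses \<open>B\<close> but has a vertex in
  \<open>A\<close>, whose non-neighbour in \<open>B\<close> would lie in \<open>X\<close>.\<close>

lemma connected_complement_aux:
  assumes N: "card (A \<times> B - parcs G) = 2 * v"
    and X: "X \<subseteq> A \<union> B" "X \<noteq> {}"
    and closed: "\<And>x y. x \<in> X \<Longrightarrow> y \<in> A \<union> B \<Longrightarrow> x \<noteq> y \<Longrightarrow> (x, y) \<notin> parcs G \<Longrightarrow> y \<in> X"
    and large: "card ((X \<inter> A) \<union> (B - X)) \<ge> v"
  shows "X = A \<union> B"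
proof -
  interpret swap: only_two_cliques G v B A by (rule only_two_cliques_swap)
  have non_nbr: "\<exists>y \<in> B. x \<noteq> y \<and> (x, y) \<notin> parcs G" if "x \<in> A" for x
  proof -
    have "{b \<in> B. (x, b) \<notin> parcs G} \<noteq> {}" using card_non_nbrs[OF N that] by force
    then show ?thesis using that disjoint by auto
  qed
  have non_nbr': "\<exists>x \<in> A. x \<noteq> y \<and> (x, y) \<notin> parcs G" if "y \<in> B" for y
  proof -
    have "{a \<in> A. (y, a) \<notin> parcs G} \<noteq> {}"
      using swap.card_non_nbrs[OF _ that] card_non_arcs_swap N by force
    then obtain a where "a \<in> A" "(y, a) \<notin> parcs G" by blast
    then show ?thesis using that disjoint sym_parcs by (intro bexI[of _ a]) auto
  qed
  have "A \<subseteq> (X \<inter> A) \<union> (B - X) \<or> B \<subseteq> (X \<inter> A) \<union> (B - X)"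
  proof (rule large_clique[OF _ _ large])
    fix x y assume "x \<in> (X \<inter> A) \<union> (B - X)" "y \<in> (X \<inter> A) \<union> (B - X)" "x \<noteq> y"
    then show "(x, y) \<in> parcs G"
      using adj_A adj_B closed sym_parcs by (metis DiffE IntE UnE UnI1 UnI2)
  qed (use verts_eq in auto)
  then show ?thesis
  proof
    assume "A \<subseteq> (X \<inter> A) \<union> (B - X)"
    then have "A \<subseteq> X" using disjoint by auto
    moreover have "y \<in> X" if "y \<in> B" for y
      using non_nbr'[OF that] \<open>A \<subseteq> X\<close> closed that by blast
    ultimately show ?thesis using X by blast
  next
    assume "B \<subseteq> (X \<inter> A) \<union> (B - X)"
    then have "X \<inter> B = {}" using disjoint by auto
    with X obtain x where "x \<in> X" "x \<in> A" by auto
    with non_nbr[of x] closed \<open>X \<inter> B = {}\<close> show ?thesis by blast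
  qed
qed

lemma connected_complement:
  assumes N: "card (A \<times> B - parcs G) = 2 * v"
    and X: "X \<subseteq> A \<union> B" "X \<noteq> {}"
    and closed: "\<And>x y. x \<in> X \<Longrightarrow> y \<in> A \<union> B \<Longrightarrow> x \<noteq> y \<Longrightarrow> (x, y) \<notin> parcs G \<Longrightarrow> y \<in> X"
  shows "X = A \<union> B"
proof -
  interpret swap: only_two_cliques G v B A by (rule only_two_cliques_swap)
  \<comment> \<open>The two sets cover all 2v vertices, so one has at least v. Swapping
    \<open>A\<close> and \<open>B\<close> exchanges them, which reduces the second case to the
    auxiliary lemma.\<close>
  let ?W = "(X \<inter> A) \<union> (B - X)" and ?W' = "(X \<inter> B) \<union> (A - X)"
  have "?W \<union> ?W' = A \<union> B" by auto
  then have "card (A \<union> B) \<le> card ?W + card ?W'" by (metis card_Un_le)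
  then have "2 * v \<le> card ?W + card ?W'"
    using disjoint finite_A finite_B card_A card_B by (simp add: card_Un_disjoint)
  then consider "card ?W \<ge> v" | "card ?W' \<ge> v" by linarith
  then show ?thesis
  proof cases
    case 1
    show ?thesis by (rule connected_complement_aux[OF N X _ 1]) (rule closed)
  next
    case 2
    then show ?thesis
      using swap.connected_complement_aux[of X] N X closed card_non_arcs_swap
      by (auto simp: Un_commute)
  qed
qed

lemma cocycle_labelling_exists:
  assumes N: "card (A \<times> B - parcs G) = 2 * v"
  shows "\<exists>f. cocycle_labelling G (2 * v) f"
proof -
  interpret swap: only_two_cliques G v B A by (rule only_two_cliques_swap)
  \<comment> \<open>Adjacency in the complement graph, to which \<open>two_regular_cycle\<close> is
    applied.\<close>
  define R where "R x y \<longleftrightarrow> x \<in> pverts G \<and> y \<in> pverts G \<and> x \<noteq> y \<and> (x, y) \<notin> parcs G" for x y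
  have card_V: "card (pverts G) = 2 * v"
    using verts_eq disjoint finite_A finite_B card_A card_B by (simp add: card_Un_disjoint)
  have deg: "card {y. R x y} = 2" if "x \<in> pverts G" for x
  proof (cases "x \<in> A")
    case True
    then have "{y. R x y} = {b \<in> B. (x, b) \<notin> parcs G}"
      using adj_A verts_eq disjoint by (auto simp: R_def)
    then show ?thesis using card_non_nbrs[OF N True] by simp
  next
    case False
    then have "x \<in> B" using that verts_eq by auto
    then have "{y. R x y} = {b \<in> A. (x, b) \<notin> parcs G}"
      using adj_B verts_eq disjoint by (auto simp: R_def)
    then show ?thesis using swap.card_non_nbrs[OF _ \<open>x \<in> B\<close>] N card_non_arcs_swap by simp
  qed
  have conn: "X = pverts G"
    if "X \<subseteq> pverts G" "X \<noteq> {}" "\<And>x y. x \<in> X \<Longrightarrow> R x y \<Longrightarrow> y \<in> X" for X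
    using connected_complement[OF N, of X] that unfolding R_def verts_eq by blast
  have "finite (pverts G)" "pverts G \<noteq> {}" using card_V v_ge_2 by (auto intro: card_ge_0_finite)
  moreover have "\<And>x y. R x y \<Longrightarrow> x \<in> pverts G" "\<And>x y. R x y \<Longrightarrow> R y x" "\<And>x. \<not> R x x"
    using sym_parcs by (auto simp: R_def)
  ultimately obtain f where f: "bij_betw f {..<card (pverts G)} (pverts G)"
    "\<And>i j. i < card (pverts G) \<Longrightarrow> j < card (pverts G) \<Longrightarrow>
       R (f i) (f j) \<longleftrightarrow> j = Suc i mod card (pverts G) \<or> i = Suc j mod card (pverts G)"
    using two_regular_cycle[of "pverts G" R] deg conn by blast
  have "(f i, f j) \<in> parcs G \<longleftrightarrow> i \<noteq> j \<and> j \<noteq> Suc i mod (2 * v) \<and> i \<noteq> Suc j mod (2 * v)"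
    if "i < 2 * v" "j < 2 * v" for i j
  proof -
    have "f i \<in> pverts G" "f j \<in> pverts G" "f i = f j \<longleftrightarrow> i = j"
      using f(1) that card_V by (auto simp: bij_betw_def inj_on_def)
    then have "(f i, f j) \<in> parcs G \<longleftrightarrow> i \<noteq> j \<and> \<not> R (f i) (f j)"
      by (auto simp: R_def dest: no_loops)
    then show ?thesis using f(2)[of i j] that card_V by auto
  qed
  then show ?thesis using f(1) card_V by (auto simp: cocycle_labelling_def)
qed

end

lemma strongly_clique_partitioned_2E:
  assumes "strongly_clique_partitioned 2 v G" "v \<ge> 2"
  obtains A B where "only_two_cliques G v A B"
proof -
  obtain P where P: "clique_decomposition G 2 v P" and G: "pair_graph G"
    and only: "\<And>S. is_clique G v S \<Longrightarrow> S \<in> P"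
    using assms by (auto simp: strongly_clique_partitioned_def weakly_clique_partitioned_def)
  then obtain A B where AB: "P = {A, B}" "A \<noteq> B"
    by (auto simp: clique_decomposition_def card_2_iff)
  interpret pair_graph G by fact
  have "only_two_cliques G v A B"
    using P AB only assms(2)
    by unfold_locales (auto simp: clique_decomposition_def partition_on_def disjoint_def)
  then show thesis by (rule that)
qed

section \<open>The graph \<open>\<Gamma>(2,v)\<close>\<close>

lemma cong_diff_0_iff:
  assumes "j < v" "l < v"
  shows "[int l - int j = 0] (mod int v) \<longleftrightarrow> l = j"
  using assms by (simp add: cong_diff_iff_cong_0 cong_int_iff) (simp add: cong_def)

text \<open>Replaces the integer congruence in \<open>Gamma\<close> by the cyclic successor, the
  form used in \<open>cocycle_labelling\<close>.\<close>

lemma cong_diff_1_iff: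
  assumes "j < v" "l < v"
  shows "[int l - int j = 1] (mod int v) \<longleftrightarrow> l = Suc j mod v"
proof -
  have "[int l - int j = 1] (mod int v) \<longleftrightarrow> [int l - int j + int j = 1 + int j] (mod int v)"
    by (rule cong_add_rcancel[symmetric])
  also have "\<dots> \<longleftrightarrow> [int l = int (Suc j)] (mod int v)" by simp
  also have "\<dots> \<longleftrightarrow> l = Suc j mod v" using assms by (simp only: cong_int_iff) (simp add: cong_def)
  finally show ?thesis .
qed

lemma pverts_Gamma: "pverts (Gamma n v) = {0..<n} \<times> {0..<v}"
  by (simp add: Gamma_def)

lemma Gamma_arc_same: "((i, j), (i, l)) \<in> parcs (Gamma n v) \<longleftrightarrow> i < n \<and> j < v \<and> l < v \<and> j \<noteq> l"
  by (auto simp: Gamma_def)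

lemma Gamma_arc_less:
  assumes "i < k" "k < n" "j < v" "l < v"
  shows "((i, j), (k, l)) \<in> parcs (Gamma n v) \<longleftrightarrow> l \<noteq> j \<and> l \<noteq> Suc j mod v"
  using assms by (simp add: Gamma_def cong_diff_0_iff cong_diff_1_iff)

lemma Gamma_arc_greater:
  assumes "k < i" "i < n" "j < v" "l < v"
  shows "((i, j), (k, l)) \<in> parcs (Gamma n v) \<longleftrightarrow> j \<noteq> l \<and> j \<noteq> Suc l mod v"
  using assms by (simp add: Gamma_def cong_diff_0_iff cong_diff_1_iff)

lemma pair_graph_Gamma: "pair_graph (Gamma n v)"
proof
  have sub: "parcs (Gamma n v) \<subseteq> pverts (Gamma n v) \<times> pverts (Gamma n v)"
    by (auto simp: Gamma_def)
  fix e assume "e \<in> parcs (Gamma n v)"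
  with sub show "fst e \<in> pverts (Gamma n v)" "snd e \<in> pverts (Gamma n v)" by auto
  show "fst e \<noteq> snd e" using \<open>e \<in> parcs (Gamma n v)\<close> by (auto simp: Gamma_def)
next
  show "finite (pverts (Gamma n v))" by (simp add: pverts_Gamma)
  have "parcs (Gamma n v) \<subseteq> pverts (Gamma n v) \<times> pverts (Gamma n v)"
    by (auto simp: Gamma_def)
  then show "finite (parcs (Gamma n v))"
    using \<open>finite (pverts (Gamma n v))\<close> by (meson finite_SigmaI finite_subset)
  show "symmetric (with_proj (Gamma n v))"
    unfolding symmetric_def sym_def by (auto simp: Gamma_def)
qed

section \<open>The cliques and non-adjacent pairs of the graph\<close>

lemma two_cliques_Gamma:
  assumes "v \<ge> 1"
  shows "two_cliques (Gamma 2 v) v ({0} \<times> {..<v}) ({1} \<times> {..<v})"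
proof -
  interpret pair_graph "Gamma 2 v" by (rule pair_graph_Gamma)
  show ?thesis
    by unfold_locales (auto simp: is_clique_def pverts_Gamma Gamma_arc_same card_cartesian_product)
qed

lemma Suc_mod_closed:
  assumes "S \<subseteq> {..<v}" "S \<noteq> {}" and closed: "\<And>j. j \<in> S \<Longrightarrow> Suc j mod v \<in> S"
  shows "S = {..<v}"
proof -
  obtain j where j: "j \<in> S" "j < v" using assms by auto
  have *: "(j + k) mod v \<in> S" for k
  proof (induction k)
    case (Suc k)
    then show ?case using closed[OF Suc] by (simp add: mod_Suc_eq)
  qed (use j in simp)
  \<comment> \<open>From \<open>j\<close>, the residue \<open>i\<close> is reached after
    \<open>v - j + i\<close> shifts: \<open>v - j\<close> lead to 0 and \<open>i\<close> more to
    \<open>i\<close>.\<close>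
  have "i \<in> S" if "i < v" for i using *[of "v - j + i"] j that by simp
  then show ?thesis using assms(1) by auto
qed

text \<open>A set \<open>S\<close> of residues and a disjoint set \<open>T\<close> of residues outside \<open>S + 1\<close> satisfy
  \<open>|T| \<le> v - |S \<union> (S + 1)|\<close>, and \<open>|S| + |T| = v\<close> makes \<open>S\<close> invariant under the shift.\<close>

lemma only_two_cliques_Gamma:
  assumes "v \<ge> 2"
  shows "only_two_cliques (Gamma 2 v) v ({0} \<times> {..<v}) ({1} \<times> {..<v})"
proof -
  interpret two_cliques "Gamma 2 v" v "{0} \<times> {..<v}" "{1} \<times> {..<v}"
    using assms by (intro two_cliques_Gamma) simp
  show ?thesis
  proof unfold_locales
    fix W assume W: "is_clique (Gamma 2 v) v W"
    define S T where "S = {j. (0, j) \<in> W}" and "T = {j. (1, j) \<in> W}"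
    have sub: "W \<subseteq> {0..<2} \<times> {0..<v}" using W by (auto simp: is_clique_def pverts_Gamma)
    then have ST: "S \<subseteq> {..<v}" "T \<subseteq> {..<v}" by (auto simp: S_def T_def)
    then have fin: "finite S" "finite T" using finite_subset by auto
    have W_eq: "W = {0} \<times> S \<union> {1} \<times> T" using sub by (auto simp: S_def T_def less_2_cases_iff)
    have card_W: "card W = v" using W by (simp add: is_clique_def)
    then have card_ST: "card S + card T = v"
      unfolding W_eq using fin by (subst (asm) card_Un_disjoint) (auto simp: card_cartesian_product)
    let ?s = "\<lambda>j. Suc j mod v"
    have adj: "l \<noteq> j \<and> l \<noteq> ?s j" if "j \<in> S" "l \<in> T" for j l
    proof -
      have "((0, j), (1, l)) \<in> parcs (Gamma 2 v)"
        using W that by (auto simp: is_clique_def S_def T_def)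
      then show ?thesis using that ST Gamma_arc_less[of 0 1 2 j v l] by auto
    qed
    have s_less: "?s j < v" for j using assms by simp
    have "T \<subseteq> {..<v} - (S \<union> ?s ` S)" using adj ST by blast
    then have "card T \<le> card ({..<v} - (S \<union> ?s ` S))" by (intro card_mono) auto
    also have "\<dots> = v - card (S \<union> ?s ` S)"
      using fin ST s_less by (subst card_Diff_subset) auto
    finally have "card (S \<union> ?s ` S) \<le> card S"
      using card_ST card_mono[of "{..<v}" "S \<union> ?s ` S"] ST s_less
      by (simp add: image_subset_iff)
    then have "S = S \<union> ?s ` S" using fin by (intro card_seteq) auto
    then have closed: "?s j \<in> S" if "j \<in> S" for j using that by auto
    show "W = {0} \<times> {..<v} \<or> W = {1} \<times> {..<v}"
    \<comment> \<open>A shift-invariant set of residues is empty or everything, and the count of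
      \<open>T\<close> then makes \<open>W\<close> one of the two rows.\<close>
    proof (cases "S = {}")
      case True
      then have "T = {..<v}" using card_ST ST by (intro card_subset_eq) auto
      then show ?thesis using True W_eq by simp
    next
      case False
      then have S: "S = {..<v}" using Suc_mod_closed[OF ST(1) _ closed] by blast
      then have "T = {}" using card_ST fin by simp
      then show ?thesis using S W_eq by simp
    qed
  qed (rule assms)
qed

text \<open>The non-neighbours of (0, j) in the other row are (1, j) and (1, j+1 mod v), which are
  distinct because v is at least 2.\<close>

lemma card_non_arcs_Gamma:
  assumes "v \<ge> 2"
  shows "card (({0} \<times> {..<v}) \<times> ({1} \<times> {..<v}) - parcs (Gamma 2 v)) = 2 * v" (is "card ?N = _")
proof -
  let ?f = "\<lambda>j. ((0::nat, j), (1::nat, j))" and ?g = "\<lambda>j. ((0::nat, j), (1::nat, Suc j mod v))"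
  have "?N = ?f ` {..<v} \<union> ?g ` {..<v}"
    using assms by (auto simp: Gamma_arc_less)
  moreover have "?f ` {..<v} \<inter> ?g ` {..<v} = {}"
    using assms by (auto simp: mod_Suc split: if_splits)
  ultimately show ?thesis
    by (simp add: card_Un_disjoint card_image inj_on_def)
qed

lemma maximal_Gamma:
  assumes "v \<ge> 2"
  shows "maximal_strongly_clique_partitioned 2 v (Gamma 2 v)"
proof -
  interpret only_two_cliques "Gamma 2 v" v "{0} \<times> {..<v}" "{1} \<times> {..<v}"
    by (rule only_two_cliques_Gamma[OF assms])
  show ?thesis
    using maximal_iff_card_non_arcs strongly card_non_arcs_Gamma[OF assms] by blast
qed

text \<open>The vertex (0, a) gets position 2a+1, between its non-neighbours (1, a) at 2a and (1,
  a+1) at 2a+2, taken cyclically.\<close>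

lemma cocycle_labelling_Gamma:
  "cocycle_labelling (Gamma 2 v) (2 * v) (\<lambda>k. (if even k then 1 else 0, k div 2))"
proof -
  let ?g = "\<lambda>k::nat. (if even k then 1 else 0::nat, k div 2)"
  have "bij_betw ?g {..<2 * v} (pverts (Gamma 2 v))"
    by (rule bij_betw_byWitness[where f' = "\<lambda>(i, j). if i = 1 then 2 * j else Suc (2 * j)"])
      (auto simp: pverts_Gamma split: if_splits)
  moreover have "(?g i, ?g j) \<in> parcs (Gamma 2 v) \<longleftrightarrow>
      i \<noteq> j \<and> j \<noteq> Suc i mod (2 * v) \<and> i \<noteq> Suc j mod (2 * v)" if "i < 2 * v" "j < 2 * v" for i j
  proof -
    have "v > 0" using that by auto
    obtain a p where a: "i = 2 * a + p" "p < 2" "a < v"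
    proof (rule that)
      show "i = 2 * (i div 2) + i mod 2" "i mod 2 < 2" "i div 2 < v"
        using \<open>i < 2 * v\<close> by auto
    qed
    obtain b q where b: "j = 2 * b + q" "q < 2" "b < v"
    proof (rule that)
      show "j = 2 * (j div 2) + j mod 2" "j mod 2 < 2" "j div 2 < v"
        using \<open>j < 2 * v\<close> by auto
    qed
    \<comment> \<open>The parities decide the rows. In each of the four cases \<open>mod_Suc\<close>
      resolves the wrap-around and leaves linear arithmetic with parity.\<close>
    have "p = 0 \<or> p = 1" "q = 0 \<or> q = 1" using a b by auto
    then show ?thesis
      using a(3) b(3) unfolding a(1) b(1)
      by (elim disjE) (simp_all add: Gamma_arc_same Gamma_arc_less Gamma_arc_greater mod_Suc, presburger+)
  qed
  ultimately show ?thesis by (simp add: cocycle_labelling_def)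
qed

theorem theorem2p6:
  fixes v :: nat
  assumes "v \<ge> 2"
  shows "maximal_strongly_clique_partitioned 2 v (Gamma 2 v) \<and>
    (\<forall>G :: 'a pair_pre_digraph.
       maximal_strongly_clique_partitioned 2 v G \<longrightarrow> graph_iso G (Gamma 2 v)) \<and>
    (\<exists>(K :: nat pair_pre_digraph) C.
       complete_digraph (2 * v) (with_proj K) \<and> hamiltonian_cycle K C \<and>
       graph_iso (Gamma 2 v) (delete_edges K (set C)))"
proof (intro conjI allI impI exI)
  interpret Gamma: pair_graph "Gamma 2 v" by (rule pair_graph_Gamma)
  show "maximal_strongly_clique_partitioned 2 v (Gamma 2 v)" by (rule maximal_Gamma[OF assms])
  show "complete_digraph (2 * v) (with_proj (complete_pair_graph (2 * v)))"
    by (rule complete_digraph_complete_pair_graph)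
  show "hamiltonian_cycle (complete_pair_graph (2 * v)) (cycle_arcs (2 * v))"
    using assms by (intro hamiltonian_cycle_cycle_arcs) simp
  show "graph_iso (Gamma 2 v) (delete_edges (complete_pair_graph (2 * v)) (set (cycle_arcs (2 * v))))"
    by (rule graph_iso_cocycle_labelling[OF Gamma.pair_wf_digraph
          pair_wf_delete_edges[OF pair_wf_complete_pair_graph]
          cocycle_labelling_Gamma cocycle_labelling_delete_edges])
  fix G :: "'a pair_pre_digraph"
  assume G: "maximal_strongly_clique_partitioned 2 v G"
  then have "strongly_clique_partitioned 2 v G"
    by (simp add: maximal_strongly_clique_partitioned_def)
  then obtain A B where "only_two_cliques G v A B"
    using strongly_clique_partitioned_2E assms by blast
  then interpret only_two_cliques G v A B .
  \<comment> \<open>The edge count of \<open>G\<close> enters as the number 2v of non-adjacent pairs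
    between \<open>A\<close> and \<open>B\<close>.\<close>
  obtain f where "cocycle_labelling G (2 * v) f"
    using cocycle_labelling_exists G maximal_iff_card_non_arcs by blast
  then show "graph_iso G (Gamma 2 v)"
    by (rule graph_iso_cocycle_labelling[OF pair_wf_digraph Gamma.pair_wf_digraph
          _ cocycle_labelling_Gamma])
qed

end
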